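(* Let $n\in\mathbb{N}$ and let $f$ be an entire function. Then $f$ preserves nonnegativity of upper-triangular matrices of order $n$ (i.e., $f(A)$ is entrywise nonnegative for every entrywise nonnegative upper-triangular $A\in\mathbb{R}^{n\times n}$) if and only if its divided differences of order up to $n$ are nonnegative over $\mathbb{R}_+$, i.e., $$f[x_1,\ldots,x_k]\ge 0\quad\text{for all } x_1,\ldots,x_k\ge 0,\qquad k=1,\ldots,n,$$ or, equivalently, if and only if all derivatives $f^{(j)}$ of $f$ of order $j=0,1,\ldots,n-1$ are nonnegative on $\mathbb{R}_+$.
   Context: $\mathbb{R}_+=[0,\infty)$. For an entire $f(z)=\sum_{j\ge0} a_j z^j$ and a square matrix $A$, $f(A)$ is the usual (primary) matrix function, $f(A)=\sum_{j\ge 0}a_jA^j$. Inequalities "$\ge 0$" for complex-valued expressions mean real and nonnegative. The divided difference of a smooth function $f$ at points $x_1,\ldots,x_k$ (which can be thought of as ordered, $x_1\le\cdots\le x_k$; divided differences are symmetric in the points) is defined by $f[x]=f(x)$ and $$f[x_1,\ldots,x_k]=\begin{cases}\dfrac{f[x_2,\ldots,x_k]-f[x_1,\ldots,x_{k-1}]}{x_k-x_1}, & x_1\ne x_k,\\[2mm] f^{(k-1)}(x_1)/(k-1)!, & x_1=x_k.\end{cases}$$ The divided difference at $k$ points is said to be of order $k$. *)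

theory Defs
  imports "HOL-Complex_Analysis.Complex_Analysis" "Jordan_Normal_Form.Matrix"
begin

text \<open>
  The matrix function \<open>f(A) = \<Sum>k. a\<^sub>k A\<^sup>k\<close>, where the \<open>a\<^sub>k\<close> are the Taylor coefficients of the
  entire function \<open>f\<close> at 0.  The type of matrices of variable dimension carries no topology,
  so the series is taken entrywise; lemma \<open>summable_entire_mat_fun\<close> shows that it converges.
\<close>

definition entire_mat_fun :: "(complex \<Rightarrow> complex) \<Rightarrow> complex mat \<Rightarrow> complex mat" where
  "entire_mat_fun f A =
     mat (dim_row A) (dim_col A)
       (\<lambda>(i, j). \<Sum>k. (deriv ^^ k) f 0 / fact k * (A ^\<^sub>m k) $$ (i, j))"

lemma norm_pow_mat_entry_le:
  fixes A :: "complex mat"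
  assumes A: "A \<in> carrier_mat n n"
    and c: "\<And>i j. i < n \<Longrightarrow> j < n \<Longrightarrow> norm (A $$ (i, j)) \<le> c"
    and "i < n" "j < n"
  shows "norm ((A ^\<^sub>m k) $$ (i, j)) \<le> (real n * c) ^ k"
  using assms(3,4)
proof (induction k arbitrary: i j)
  case 0
  then show ?case using A by (auto simp: one_mat_def)
next
  case (Suc k)
  have P: "A ^\<^sub>m k \<in> carrier_mat n n" using A by simp
  have c0: "c \<ge> 0" using c[OF Suc.prems] norm_ge_zero order_trans by blast
  have "(A ^\<^sub>m Suc k) $$ (i, j) = (\<Sum>l<n. (A ^\<^sub>m k) $$ (i, l) * A $$ (l, j))"
    using A P Suc.prems by (auto simp: scalar_prod_def lessThan_atLeast0 intro!: sum.cong)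
  also have "norm \<dots> \<le> (\<Sum>l<n. (real n * c) ^ k * c)"
    using c0 Suc c
    by (intro order_trans[OF norm_sum] sum_mono) (auto simp: norm_mult intro!: mult_mono)
  finally show ?case by (simp add: mult_ac)
qed

lemma summable_entire_mat_fun:
  fixes A :: "complex mat"
  assumes f: "f holomorphic_on UNIV" and A: "A \<in> carrier_mat n n" and "i < n" "j < n"
  shows "summable (\<lambda>k. (deriv ^^ k) f 0 / fact k * (A ^\<^sub>m k) $$ (i, j))"
proof -
  define c where "c = Max ((\<lambda>(i, j). norm (A $$ (i, j))) ` ({..<n} \<times> {..<n}))"
  have c: "norm (A $$ (i, j)) \<le> c" if "i < n" "j < n" for i j
    unfolding c_def using that by (intro Max_ge) force+
  define a where "a k = (deriv ^^ k) f 0 / fact k" for k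
  have sm: "summable (\<lambda>k. a k * z ^ k)" for z
  proof -
    have "((\<lambda>k. (deriv ^^ k) f 0 / fact k * (z - 0) ^ k) sums f z)"
      by (rule holomorphic_power_series[where r = "norm z + 1"])
         (use f in \<open>auto intro: holomorphic_on_subset\<close>)
    then show ?thesis by (auto simp: a_def sums_iff)
  qed
  have c0: "c \<ge> 0" using c[OF assms(3,4)] norm_ge_zero order_trans by blast
  have "summable (\<lambda>k. norm (a k * of_real (real n * c) ^ k))"
    by (rule powser_insidea[OF sm[of "of_real (real n * c + 1)"]])
       (use c0 in \<open>simp del: of_real_add of_real_mult\<close>)
  then have "summable (\<lambda>k. a k * (A ^\<^sub>m k) $$ (i, j))"
    by (rule summable_comparison_test'[where N = 0])
       (use c0 norm_pow_mat_entry_le[OF A c assms(3,4)] in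
         \<open>auto simp: norm_mult norm_power abs_mult intro!: mult_left_mono\<close>)
  then show ?thesis by (simp add: a_def)
qed

definition preserves_nonneg_upper_triangular :: "nat \<Rightarrow> (complex \<Rightarrow> complex) \<Rightarrow> bool" where
  "preserves_nonneg_upper_triangular n f \<longleftrightarrow>
     (\<forall>A :: real mat. A \<in> carrier_mat n n \<and> upper_triangular A \<and>
        (\<forall>i<n. \<forall>j<n. 0 \<le> A $$ (i, j)) \<longrightarrow>
        (\<forall>i<n. \<forall>j<n. entire_mat_fun f (map_mat complex_of_real A) $$ (i, j) \<in> \<real>\<^sub>\<ge>\<^sub>0))"

text \<open>
  The recursion below is the usual one for points in nondecreasing order; only then does equality
  of the first and the last point mean that all points coincide.  Its first equation is a dummy
  value.  Arbitrary points are sorted first.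
\<close>

fun divided_difference_sorted :: "(complex \<Rightarrow> complex) \<Rightarrow> real list \<Rightarrow> complex" where
  "divided_difference_sorted f [] = 0"
| "divided_difference_sorted f [x] = f (of_real x)"
| "divided_difference_sorted f (x # y # ys) =
     (let xs = x # y # ys; k = length xs in
      if hd xs \<noteq> last xs
      then (divided_difference_sorted f (tl xs) - divided_difference_sorted f (butlast xs))
             / of_real (last xs - hd xs)
      else (deriv ^^ (k - 1)) f (of_real (hd xs)) / fact (k - 1))"

definition divided_difference :: "(complex \<Rightarrow> complex) \<Rightarrow> real list \<Rightarrow> complex" where
  "divided_difference f xs = divided_difference_sorted f (sort xs)"

end

theory Submission
  imports Defs "Jordan_Normal_Form.Jordan_Normal_Form"
begin

text \<open>
  Write \<open>L\<close> for the backward shift on the Taylor coefficient sequence \<open>a\<close> of \<open>f\<close> at 0 and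
  \<open>R\<^sub>x = (1 - x L)\<^sup>-\<^sup>1\<close>, so that \<open>f(x)\<close> is the 0th entry of \<open>R\<^sub>x a\<close>.  The resolvent identity
  \<open>(x - y) L R\<^sub>x R\<^sub>y = R\<^sub>x - R\<^sub>y\<close> is the recursion of divided differences: \<open>f[x\<^sub>1, \<dots>, x\<^sub>k]\<close> is
  entry \<open>k - 1\<close> of \<open>R\<^bsub>x\<^sub>1\<^esub> \<dots> R\<^bsub>x\<^sub>k\<^esub> a\<close>, and \<open>f\<^sup>(\<^sup>m\<^sup>)(x) / m!\<close> is entry \<open>m\<close> of \<open>R\<^sub>x\<^sup>m\<^sup>+\<^sup>1 a\<close>.  By Taylor's
  theorem, if the derivatives of \<open>f\<close> of order at most \<open>m\<close> are nonnegative on the half-line, then so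
  are those of order less than \<open>m\<close> of \<open>t \<mapsto> f[y, t]\<close>, whose coefficients are \<open>L R\<^sub>y a\<close>; this gives
  nonnegative divided differences by induction.  For upper triangular \<open>A\<close> the recurrence
  \<open>(A\<^sup>k\<^sup>+\<^sup>1)\<^sub>i\<^sub>j = A\<^sub>j\<^sub>j (A\<^sup>k)\<^sub>i\<^sub>j + \<Sum>\<^sub>l\<^sub><\<^sub>j (A\<^sup>k)\<^sub>i\<^sub>l A\<^sub>l\<^sub>j\<close> turns into
  \<open>f(A)\<^sub>i\<^sub>j = \<delta>\<^sub>i\<^sub>j f(A\<^sub>j\<^sub>j) + \<Sum>\<^sub>l\<^sub><\<^sub>j g(A)\<^sub>i\<^sub>l A\<^sub>l\<^sub>j\<close> with \<open>g(t) = f[A\<^sub>j\<^sub>j, t]\<close>, and induction applies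
  again.  Conversely, a Jordan block has the derivatives in its first row.  All this is applied
  to the real coefficient sequences \<open>Re \<circ> a\<close>, \<open>Im \<circ> a\<close> and \<open>- Im \<circ> a\<close>.
\<close>

section \<open>Entire coefficient sequences and the resolvent of the backward shift\<close>

definition entire_coeffs :: "(nat \<Rightarrow> real) \<Rightarrow> bool" where
  "entire_coeffs a \<longleftrightarrow> (\<forall>x. summable (\<lambda>k. a k * x ^ k))"

text \<open>Entry \<open>i\<close> of the Neumann series \<open>\<Sum>k. x ^ k L ^ k\<close> applied
  to \<open>a\<close>, since \<open>L ^ k\<close> moves \<open>a (k + i)\<close> to position
  \<open>i\<close>.\<close>

definition resolvent :: "real \<Rightarrow> (nat \<Rightarrow> real) \<Rightarrow> nat \<Rightarrow> real" where
  "resolvent x a i = (\<Sum>k. a (k + i) * x ^ k)"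

lemma entire_coeffs_Suc: "entire_coeffs a \<Longrightarrow> entire_coeffs (\<lambda>i. a (Suc i))"
  unfolding entire_coeffs_def using summable_powser_split_head by blast

lemma entire_coeffs_shift: "entire_coeffs a \<Longrightarrow> entire_coeffs (\<lambda>i. a (i + n))"
proof (induction n)
  case (Suc n)
  then show ?case using entire_coeffs_Suc[of "\<lambda>i. a (i + n)"] by simp
qed simp

lemma entire_coeffs_add:
  "entire_coeffs a \<Longrightarrow> entire_coeffs b \<Longrightarrow> entire_coeffs (\<lambda>i. a i + b i)"
  unfolding entire_coeffs_def by (simp add: ring_distribs summable_add)

lemma entire_coeffs_mult: "entire_coeffs a \<Longrightarrow> entire_coeffs (\<lambda>i. c * a i)"
  unfolding entire_coeffs_def by (simp add: mult.assoc summable_mult)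

lemma summable_resolvent: "entire_coeffs a \<Longrightarrow> summable (\<lambda>k. a (k + i) * x ^ k)"
  using entire_coeffs_shift[of a i] unfolding entire_coeffs_def by simp

text \<open>A Cauchy estimate: the terms of the convergent series at \<open>R\<close> are bounded.
  The radius \<open>R\<close> is free, so it can be fitted to the points at hand.\<close>

lemma entire_coeffs_bound:
  assumes "entire_coeffs a" "R > 0"
  obtains C where "C \<ge> 0" "\<And>k. \<bar>a k\<bar> \<le> C / R ^ k"
proof -
  have "summable (\<lambda>k. a k * R ^ k)" using assms unfolding entire_coeffs_def by simp
  then have "Bseq (\<lambda>k. a k * R ^ k)"
    by (intro convergent_imp_Bseq) (auto intro: summable_LIMSEQ_zero simp: convergent_def)
  then obtain C where "C > 0" "\<And>k. norm (a k * R ^ k) \<le> C" by (rule BseqE) auto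
  then show ?thesis using assms(2) by (intro that[of C]) (auto simp: field_simps abs_mult)
qed

lemma entire_coeffs_resolvent:
  assumes "entire_coeffs a" shows "entire_coeffs (resolvent x a)"
  unfolding entire_coeffs_def
proof
  fix z :: real
  \<comment> \<open>With this radius both the series in \<open>x\<close> defining the resolvent and
    the outer series in \<open>z\<close> are dominated by geometric series of ratio 1/2.\<close>
  define R where "R = 2 * (\<bar>x\<bar> + \<bar>z\<bar> + 1)"
  have R: "R > 0" "\<bar>x\<bar> / R \<le> 1 / 2" "\<bar>z\<bar> / R \<le> 1 / 2" by (auto simp: R_def field_simps)
  obtain C where C: "C \<ge> 0" "\<And>k. \<bar>a k\<bar> \<le> C / R ^ k"
    using entire_coeffs_bound[OF assms R(1)] by blast
  have bnd: "\<bar>resolvent x a i\<bar> \<le> 2 * C / R ^ i" for i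
  proof -
    have "\<bar>a (k + i) * x ^ k\<bar> \<le> C / R ^ i * (1 / 2) ^ k" for k
    proof -
      have "\<bar>a (k + i) * x ^ k\<bar> \<le> C / R ^ (k + i) * \<bar>x\<bar> ^ k"
        using mult_right_mono[OF C(2)[of "k + i"], of "\<bar>x\<bar> ^ k"]
        by (simp add: abs_mult power_abs)
      also have "\<dots> = C / R ^ i * (\<bar>x\<bar> / R) ^ k" by (simp add: power_add power_divide)
      also have "\<dots> \<le> C / R ^ i * (1 / 2) ^ k"
        using R C(1) by (intro mult_left_mono power_mono) auto
      finally show ?thesis .
    qed
    then have "norm (\<Sum>k. a (k + i) * x ^ k) \<le> (\<Sum>k. C / R ^ i * (1 / 2) ^ k)"
      by (intro norm_suminf_le) (auto intro!: summable_mult summable_geometric)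
    also have "\<dots> = C / R ^ i * (\<Sum>k. (1 / 2) ^ k)"
      by (intro suminf_mult summable_geometric) simp
    finally show ?thesis by (simp add: resolvent_def suminf_geometric mult.commute)
  qed
  show "summable (\<lambda>i. resolvent x a i * z ^ i)"
  proof (rule summable_comparison_test'[where N = 0])
    show "summable (\<lambda>i. 2 * C * (1 / 2 :: real) ^ i)"
      by (intro summable_mult summable_geometric) simp
    fix i
    have "\<bar>resolvent x a i * z ^ i\<bar> \<le> 2 * C / R ^ i * \<bar>z\<bar> ^ i"
      using mult_right_mono[OF bnd[of i], of "\<bar>z\<bar> ^ i"] by (simp add: abs_mult power_abs)
    also have "\<dots> = 2 * C * (\<bar>z\<bar> / R) ^ i" by (simp add: power_divide)
    also have "\<dots> \<le> 2 * C * (1 / 2) ^ i"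
      using R C(1) by (intro mult_left_mono power_mono) auto
    finally show "norm (resolvent x a i * z ^ i) \<le> 2 * C * (1 / 2) ^ i" by simp
  qed
qed

lemma resolvent_rec:
  assumes "entire_coeffs a"
  shows "resolvent x a i = a i + x * resolvent x a (Suc i)"
proof -
  have "(\<Sum>k. a (Suc k + i) * x ^ Suc k) = resolvent x a i - a i"
    using suminf_split_head[OF summable_resolvent[OF assms, of i x]]
    by (simp add: resolvent_def)
  moreover have "(\<Sum>k. a (Suc k + i) * x ^ Suc k) = x * resolvent x a (Suc i)"
    using suminf_mult[OF summable_resolvent[OF assms, of "Suc i" x], of x]
    by (simp add: resolvent_def mult_ac)
  ultimately show ?thesis by simp
qed

text \<open>The operator \<open>1 - x L\<close> is injective on entire sequences. An element
  \<open>u\<close> of its kernel has \<open>u (k + i) * x ^ k = u i\<close> for all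
  \<open>k\<close>, and the terms of a convergent series tend to 0. Identities between resolvents
  thus reduce to checking one recurrence.\<close>

lemma resolvent_unique:
  assumes a: "entire_coeffs a" and v: "entire_coeffs v"
    and rec: "\<And>i. v i = a i + x * v (Suc i)"
  shows "v = resolvent x a"
proof
  fix i
  define u where "u i = v i + (- 1) * resolvent x a i" for i
  have u: "entire_coeffs u"
    unfolding u_def
    by (intro entire_coeffs_add entire_coeffs_mult entire_coeffs_resolvent a v)
  have step: "u j = x * u (Suc j)" for j
    using rec[of j] resolvent_rec[OF a, of x j] by (simp add: u_def algebra_simps)
  have "u (k + i) * x ^ k = u i" for k
  proof (induction k)
    case (Suc k)
    then show ?case using step[of "k + i"] by (simp add: mult_ac)
  qed simp
  then have "summable (\<lambda>k::nat. u i)" using summable_resolvent[OF u, of i x] by simp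
  then have "u i = 0" using summable_LIMSEQ_zero LIMSEQ_const_iff by blast
  then show "v i = resolvent x a i" by (simp add: u_def)
qed

lemma resolvent_Suc: "resolvent x (\<lambda>i. a (Suc i)) = (\<lambda>i. resolvent x a (Suc i))"
  by (simp add: resolvent_def fun_eq_iff)

lemma resolvent_lin:
  assumes "entire_coeffs a" "entire_coeffs b"
  shows "resolvent x (\<lambda>i. a i + c * b i) = (\<lambda>i. resolvent x a i + c * resolvent x b i)"
proof
  fix i
  show "resolvent x (\<lambda>i. a i + c * b i) i = resolvent x a i + c * resolvent x b i"
    using suminf_add[OF summable_resolvent[OF assms(1), of i x]
        summable_mult[OF summable_resolvent[OF assms(2), of i x], of c]]
      suminf_mult[OF summable_resolvent[OF assms(2), of i x], of c]
    by (simp add: resolvent_def ring_distribs mult.assoc)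
qed

text \<open>Applying the resolvent at \<open>y\<close>, which is linear and commutes with the shift,
  to the recurrence for \<open>resolvent x a\<close> gives the recurrence that characterizes
  \<open>resolvent x (resolvent y a)\<close>.\<close>

lemma resolvent_commute:
  assumes a: "entire_coeffs a"
  shows "resolvent x (resolvent y a) = resolvent y (resolvent x a)"
proof (rule sym, rule resolvent_unique)
  fix i
  let ?b = "resolvent x a"
  have b: "entire_coeffs ?b" by (rule entire_coeffs_resolvent[OF a])
  have "(\<lambda>i. a i + x * ?b (Suc i)) = ?b"
    by (rule ext) (rule resolvent_rec[OF a, symmetric])
  then show "resolvent y ?b i = resolvent y a i + x * resolvent y ?b (Suc i)"
    using resolvent_lin[OF a entire_coeffs_Suc[OF b], of y x] resolvent_Suc[of y ?b] by metis
qed (intro entire_coeffs_resolvent a)+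

lemma resolvent_identity:
  assumes a: "entire_coeffs a"
  shows "(x - y) * resolvent x (resolvent y a) (Suc i) = resolvent x a i - resolvent y a i"
proof -
  let ?r = "resolvent y a"
  let ?v = "\<lambda>i. ?r i + (x - y) * resolvent x ?r (Suc i)"
  have r: "entire_coeffs ?r" by (rule entire_coeffs_resolvent[OF a])
  have "?v = resolvent x a"
  proof (rule resolvent_unique[OF a])
    show "entire_coeffs ?v"
      by (intro entire_coeffs_add entire_coeffs_mult entire_coeffs_Suc entire_coeffs_resolvent a)
    show "?v i = a i + x * ?v (Suc i)" for i
      using resolvent_rec[OF a, of y i] resolvent_rec[OF r, of x "Suc i"]
      by (simp add: algebra_simps)
  qed
  then have "?v i = resolvent x a i" by metis
  then show ?thesis by simp
qed

lemma entire_coeffs_fold_resolvent: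
  "entire_coeffs a \<Longrightarrow> entire_coeffs (fold resolvent xs a)"
  by (induction xs arbitrary: a) (auto intro: entire_coeffs_resolvent)

lemma fold_resolvent_commute:
  "entire_coeffs a \<Longrightarrow> fold resolvent xs (resolvent x a) = resolvent x (fold resolvent xs a)"
proof (induction xs arbitrary: a)
  case (Cons z xs)
  have "fold resolvent (z # xs) (resolvent x a) = fold resolvent xs (resolvent x (resolvent z a))"
    by (simp only: fold_simps resolvent_commute[OF Cons.prems, of z x])
  also have "\<dots> = resolvent x (fold resolvent xs (resolvent z a))"
    by (rule Cons.IH[OF entire_coeffs_resolvent[OF Cons.prems]])
  finally show ?case by simp
qed simp

lemma fold_resolvent_Suc:
  "fold resolvent xs (\<lambda>i. a (Suc i)) = (\<lambda>i. fold resolvent xs a (Suc i))"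
proof (induction xs arbitrary: a)
  case (Cons z xs)
  show ?case by (simp only: fold_simps resolvent_Suc[of z a] Cons.IH)
qed simp

text \<open>The recursion of divided differences. Once the inner points \<open>xs\<close> are
  absorbed into the sequence, this is the resolvent identity for the two end points.\<close>

lemma fold_resolvent_ends:
  assumes a: "entire_coeffs a"
  shows "(y - x) * fold resolvent (x # xs @ [y]) a (Suc i) =
           fold resolvent (xs @ [y]) a i - fold resolvent (x # xs) a i"
  using resolvent_identity[OF entire_coeffs_fold_resolvent[OF a], of y x xs i]
  by (simp add: fold_resolvent_commute a)

section \<open>Powers of a resolvent as binomial series\<close>

lemma entire_coeffs_binomial_series:
  assumes "entire_coeffs a"
  shows "summable (\<lambda>k. real ((k + m) choose m) * (a (k + i) * x ^ k))"
    and "entire_coeffs (\<lambda>i. \<Sum>k. real ((k + m) choose m) * (a (k + i) * x ^ k))"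
proof -
  have abs: "entire_coeffs (\<lambda>k. \<bar>a k\<bar>)"
    unfolding entire_coeffs_def
  proof
    fix z :: real
    have "summable (\<lambda>k. a k * (\<bar>z\<bar> + 1) ^ k)"
      using assms by (simp add: entire_coeffs_def)
    then have "summable (\<lambda>k. norm (a k * z ^ k))" by (rule powser_insidea) simp
    then show "summable (\<lambda>k. \<bar>a k\<bar> * z ^ k)"
      by (rule summable_comparison_test'[where N = 0]) (simp add: abs_mult power_abs)
  qed
  \<comment> \<open>The majorant comes from bounding the binomial coefficient by
    \<open>2 ^ (k + m)\<close>: the factor \<open>2 ^ k\<close> is absorbed by doubling the point,
    so everything is controlled by the resolvent of \<open>\<bar>a\<bar>\<close> at
    \<open>2 * \<bar>x\<bar>\<close>.\<close>
  let ?g = "\<lambda>i k. 2 ^ m * (\<bar>a (k + i)\<bar> * (2 * \<bar>x\<bar>) ^ k)"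
  have bnd: "norm (real ((k + m) choose m) * (a (k + i) * x ^ k)) \<le> ?g i k" for i k
  proof -
    have "real ((k + m) choose m) \<le> 2 ^ (k + m)"
      using binomial_le_pow2[of "k + m" m] by (metis of_nat_le_iff of_nat_numeral of_nat_power)
    then have "norm (real ((k + m) choose m) * (a (k + i) * x ^ k))
        \<le> 2 ^ (k + m) * \<bar>a (k + i) * x ^ k\<bar>"
      by (auto simp: abs_mult intro!: mult_right_mono)
    then show ?thesis by (simp add: abs_mult power_abs power_add power_mult_distrib mult_ac)
  qed
  have g: "summable (?g i)" for i
    by (rule summable_mult[OF summable_resolvent[OF abs]])
  show "summable (\<lambda>k. real ((k + m) choose m) * (a (k + i) * x ^ k))" for i
    by (rule summable_comparison_test'[where N = 0, OF g bnd])
  let ?r = "resolvent (2 * \<bar>x\<bar>) (\<lambda>k. \<bar>a k\<bar>)"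
  have r: "entire_coeffs ?r" by (rule entire_coeffs_resolvent[OF abs])
  have le: "norm (\<Sum>k. real ((k + m) choose m) * (a (k + i) * x ^ k)) \<le> 2 ^ m * ?r i" for i
  proof -
    have "suminf (?g i) = 2 ^ m * ?r i"
      unfolding resolvent_def by (rule suminf_mult[OF summable_resolvent[OF abs]])
    then show ?thesis using norm_suminf_le[OF bnd g, of i] by simp
  qed
  show "entire_coeffs (\<lambda>i. \<Sum>k. real ((k + m) choose m) * (a (k + i) * x ^ k))"
    unfolding entire_coeffs_def
  proof
    fix z :: real
    have "summable (\<lambda>i. 2 ^ m * (?r i * \<bar>z\<bar> ^ i))"
      using r by (intro summable_mult) (simp add: entire_coeffs_def)
    then show "summable (\<lambda>i. (\<Sum>k. real ((k + m) choose m) * (a (k + i) * x ^ k)) * z ^ i)"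
    proof (rule summable_comparison_test'[where N = 0])
      fix i
      show "norm ((\<Sum>k. real ((k + m) choose m) * (a (k + i) * x ^ k)) * z ^ i)
              \<le> 2 ^ m * (?r i * \<bar>z\<bar> ^ i)"
        using mult_right_mono[OF le[of i], of "\<bar>z\<bar> ^ i"]
        by (simp add: abs_mult power_abs mult.assoc)
    qed
  qed
qed

text \<open>The binomial series of \<open>1 - x L\<close> to the power \<open>- (m + 1)\<close>.
  Pascal's rule is exactly the recurrence by which \<open>resolvent_unique\<close> passes from
  \<open>m\<close> to \<open>m + 1\<close>.\<close>

lemma resolvent_power:
  assumes a: "entire_coeffs a"
  shows "(resolvent x ^^ Suc m) a = (\<lambda>i. \<Sum>k. real ((k + m) choose m) * (a (k + i) * x ^ k))"
proof (induction m)
  case 0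
  show ?case by (simp add: resolvent_def fun_eq_iff)
next
  case (Suc m)
  let ?s = "\<lambda>m i k. real ((k + m) choose m) * (a (k + i) * x ^ k)"
  note sm = entire_coeffs_binomial_series(1)[OF a]
  have "suminf (?s (Suc m) i) = suminf (?s m i) + x * suminf (?s (Suc m) (Suc i))" for i
  proof -
    have "suminf (?s (Suc m) i) - a i = (\<Sum>k. ?s (Suc m) i (Suc k))"
      using suminf_split_head[OF sm[of "Suc m" i x]] by simp
    \<comment> \<open>Pascal's rule, termwise.\<close>
    also have "\<dots> = (\<Sum>k. ?s m i (Suc k) + x * ?s (Suc m) (Suc i) k)"
      by (intro suminf_cong) (simp add: algebra_simps)
    also have "\<dots> = (\<Sum>k. ?s m i (Suc k)) + (\<Sum>k. x * ?s (Suc m) (Suc i) k)"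
      using sm[of m i x]
      by (intro suminf_add[symmetric] summable_mult sm) (subst summable_Suc_iff)
    also have "(\<Sum>k. ?s m i (Suc k)) = suminf (?s m i) - a i"
      using suminf_split_head[OF sm[of m i x]] by simp
    also have "(\<Sum>k. x * ?s (Suc m) (Suc i) k) = x * suminf (?s (Suc m) (Suc i))"
      by (rule suminf_mult[OF sm])
    finally show ?thesis by simp
  qed
  then have "(\<lambda>i. suminf (?s (Suc m) i)) = resolvent x (\<lambda>i. suminf (?s m i))"
    by (intro resolvent_unique entire_coeffs_binomial_series(2)[OF a]) blast
  then show ?case using Suc.IH by simp
qed

section \<open>Derivatives and a mean value theorem for divided differences\<close>

lemma entire_coeffs_diffs: "entire_coeffs a \<Longrightarrow> entire_coeffs ((diffs ^^ m) a)"
  by (induction m) (auto simp: entire_coeffs_def intro: termdiff_converges_all)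

lemma funpow_diffs:
  fixes a :: "nat \<Rightarrow> real"
  shows "(diffs ^^ m) a k = fact (k + m) / fact k * a (k + m)"
  proof (induction m arbitrary: k)
  case (Suc m)
  have "(diffs ^^ Suc m) a k = real (Suc k) * ((fact (Suc k + m) / fact (Suc k)) * a (Suc k + m))"
    by (simp only: funpow.simps comp_apply diffs_def Suc)
  also have "\<dots> = fact (k + Suc m) / fact k * a (k + Suc m)"
    by (simp add: fact_Suc[of k] del: of_nat_Suc fact_Suc)
  finally show ?case .
qed simp

text \<open>The left side is the derivative of order \<open>m\<close> of the power series at
  \<open>x\<close>; dividing \<open>(k + m)! / k!\<close> by \<open>m!\<close> leaves the binomial
  coefficient of \<open>resolvent_power\<close>.\<close>

lemma resolvent_power_eq_diffs:
  assumes a: "entire_coeffs a"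
  shows "(\<Sum>k. (diffs ^^ m) a k * x ^ k) = fact m * (resolvent x ^^ Suc m) a m"
proof -
  have "(\<Sum>k. (diffs ^^ m) a k * x ^ k) =
      (\<Sum>k. fact m * (real ((k + m) choose m) * (a (k + m) * x ^ k)))"
    by (intro suminf_cong) (simp add: funpow_diffs binomial_fact)
  then show ?thesis
    using suminf_mult[OF entire_coeffs_binomial_series(1)[OF a], of "fact m" m m x]
    unfolding resolvent_power[OF a] by simp
qed

lemma entire_coeffs_resolvent_power:
  "entire_coeffs a \<Longrightarrow> entire_coeffs ((resolvent x ^^ m) a)"
  by (induction m) (auto intro: entire_coeffs_resolvent)

text \<open>Newton interpolation at \<open>r\<close> coincident nodes \<open>t\<close>; the
  remainder carries the divided difference at \<open>y\<close> and \<open>r\<close> copies of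
  \<open>t\<close>. The resolvent identity peels off one node per step, so no analysis enters beyond
  convergence.\<close>

lemma newton_expansion:
  assumes a: "entire_coeffs a"
  shows "resolvent y a 0 = (\<Sum>j<r. (resolvent t ^^ Suc j) a j * (y - t) ^ j) +
           (y - t) ^ r * resolvent y ((resolvent t ^^ r) a) r"
proof (induction r)
  case (Suc r)
  let ?b = "(resolvent t ^^ r) a"
  have "(y - t) ^ Suc r * resolvent y (resolvent t ?b) (Suc r)
      = (y - t) ^ r * (resolvent y ?b r - resolvent t ?b r)"
    unfolding power_Suc2 mult.assoc
    using resolvent_identity[OF entire_coeffs_resolvent_power[OF a, of r t], of y t r]
    by simp
  then show ?case using Suc by (simp add: algebra_simps)
qed simp

text \<open>The Newton remainder and the Lagrange remainder of Taylor's theorem complete the same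
  polynomial, so cancelling \<open>(y - t) ^ r\<close> identifies them. The intermediate point lies
  between \<open>y\<close> and \<open>t\<close>, hence on the half-line.\<close>

lemma mean_value_divided_difference:
  assumes a: "entire_coeffs a" and y: "y \<ge> 0" and t: "t \<ge> 0" and r: "r > 0"
  shows "\<exists>\<xi>\<ge>0. resolvent y ((resolvent t ^^ r) a) r = (resolvent \<xi> ^^ Suc r) a r"
proof (cases "y = t")
  \<comment> \<open>Nothing can be cancelled here, but all points coincide and \<open>y\<close>
    itself is the witness.\<close>
  case True
  with y show ?thesis by auto
next
  case False
  let ?d = "\<lambda>m x. \<Sum>k. (diffs ^^ m) a k * x ^ k"
  have der: "(?d m has_field_derivative ?d (Suc m) x) (at x)" for m x
    using termdiffs_strong_converges_everywhere[of "(diffs ^^ m) a"] entire_coeffs_diffs[OF a, of m]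
    by (simp add: entire_coeffs_def)
  have d: "?d m x / fact m = (resolvent x ^^ Suc m) a m" for m x
    using resolvent_power_eq_diffs[OF a, of m x] by simp
  have "\<exists>s. (if y < t then y < s \<and> s < t else t < s \<and> s < y) \<and>
      ?d 0 y = (\<Sum>m<r. ?d m t / fact m * (y - t) ^ m) + ?d r s / fact r * (y - t) ^ r"
    by (rule Taylor[where diff = ?d and a = "min y t" and b = "max y t"]) (use r False der in simp_all)
  then obtain s where s: "if y < t then y < s \<and> s < t else t < s \<and> s < y"
    and eq: "?d 0 y = (\<Sum>m<r. ?d m t / fact m * (y - t) ^ m) + ?d r s / fact r * (y - t) ^ r"
    by blast
  have "?d 0 y = resolvent y a 0" by (simp add: resolvent_def)
  with eq newton_expansion[OF a, where y = y and r = r and t = t]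
  have "(y - t) ^ r * resolvent y ((resolvent t ^^ r) a) r = (resolvent s ^^ Suc r) a r * (y - t) ^ r"
    unfolding d by (simp only: mult.commute[of "(y - t) ^ r"])
  with False have "resolvent y ((resolvent t ^^ r) a) r = (resolvent s ^^ Suc r) a r"
    by simp
  moreover have "s \<ge> 0" using s y t by (auto split: if_splits)
  ultimately show ?thesis by blast
qed

section \<open>From nonnegative derivatives to nonnegative divided differences\<close>

definition nonneg_derivs :: "nat \<Rightarrow> (nat \<Rightarrow> real) \<Rightarrow> bool" where
  "nonneg_derivs m a \<longleftrightarrow> (\<forall>r<m. \<forall>t\<ge>0. 0 \<le> (resolvent t ^^ Suc r) a r)"

lemma resolvent_power_commute:
  assumes a: "entire_coeffs a"
  shows "(resolvent x ^^ m) (\<lambda>i. resolvent y a (Suc i)) = (\<lambda>i. resolvent y ((resolvent x ^^ m) a) (Suc i))"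
proof (induction m)
  case (Suc m)
  have "(resolvent x ^^ Suc m) (\<lambda>i. resolvent y a (Suc i)) =
      (\<lambda>i. resolvent x (resolvent y ((resolvent x ^^ m) a)) (Suc i))"
    by (simp only: funpow.simps comp_apply Suc resolvent_Suc[of x "resolvent y ((resolvent x ^^ m) a)"])
  also have "resolvent x (resolvent y ((resolvent x ^^ m) a)) = resolvent y ((resolvent x ^^ Suc m) a)"
    by (simp only: funpow.simps comp_apply resolvent_commute[OF entire_coeffs_resolvent_power[OF a], of x y])
  finally show ?case .
qed simp

text \<open>The new sequence belongs to \<open>g(t) = f[y, t]\<close>. The scaled derivative of
  order \<open>r\<close> of \<open>g\<close> at \<open>t\<close> is the divided difference of
  \<open>f\<close> at \<open>y\<close> and \<open>r + 1\<close> copies of \<open>t\<close>, which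
  the mean value theorem turns into a scaled derivative of \<open>f\<close> of order
  \<open>r + 1\<close>.\<close>

lemma nonneg_derivs_resolvent:
  assumes a: "entire_coeffs a" and Q: "nonneg_derivs (Suc m) a" and y: "y \<ge> 0"
  shows "nonneg_derivs m (\<lambda>i. resolvent y a (Suc i))"
  unfolding nonneg_derivs_def
proof (intro allI impI)
  fix r and t :: real
  assume r: "r < m" and t: "0 \<le> t"
  obtain \<xi> where "\<xi> \<ge> 0"
    "resolvent y ((resolvent t ^^ Suc r) a) (Suc r) = (resolvent \<xi> ^^ Suc (Suc r)) a (Suc r)"
    using mean_value_divided_difference[OF a y t, of "Suc r"] by blast
  moreover have "0 \<le> (resolvent \<xi> ^^ Suc (Suc r)) a (Suc r)" if "\<xi> \<ge> 0"
    using Q r that unfolding nonneg_derivs_def by blast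
  ultimately show "0 \<le> (resolvent t ^^ Suc r) (\<lambda>i. resolvent y a (Suc i)) r"
    unfolding resolvent_power_commute[OF a] by simp
qed

lemma nonneg_derivs_eval: "nonneg_derivs (Suc m) a \<Longrightarrow> x \<ge> 0 \<Longrightarrow> 0 \<le> resolvent x a 0"
  unfolding nonneg_derivs_def by (metis funpow_0 funpow.simps(2) comp_apply zero_less_Suc)

text \<open>Removing the first point \<open>y\<close> replaces \<open>f\<close> by
  \<open>t \<mapsto> f[y, t]\<close>. This costs one point and one order of nonnegative derivatives,
  so the bound \<open>length xs \<le> m\<close> persists.\<close>

lemma fold_resolvent_nonneg:
  assumes "entire_coeffs a" "nonneg_derivs m a" "length xs \<le> m" "xs \<noteq> []" "\<forall>x\<in>set xs. 0 \<le> x"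
  shows "0 \<le> fold resolvent xs a (length xs - 1)"
  using assms
proof (induction xs arbitrary: a m)
  case (Cons y xs)
  then obtain m' where m: "m = Suc m'" by (cases m) auto
  let ?b = "\<lambda>i. resolvent y a (Suc i)"
  show ?case
  proof (cases xs)
    case Nil
    then show ?thesis using Cons.prems nonneg_derivs_eval m by auto
  next
    case (Cons z zs)
    have "0 \<le> fold resolvent xs ?b (length xs - 1)"
      using Cons.prems Cons m
      by (intro Cons.IH[of _ m'] nonneg_derivs_resolvent entire_coeffs_Suc entire_coeffs_resolvent)
         auto
    then show ?thesis using Cons unfolding fold_resolvent_Suc by simp
  qed
qed simp

section \<open>Power series in nonnegative upper triangular matrices\<close>

lemma summable_mult_entire_coeffs:
  assumes b: "entire_coeffs b" and t: "\<And>k. \<bar>t k\<bar> \<le> B ^ k"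
  shows "summable (\<lambda>k. t k * b k)"
proof (rule summable_comparison_test'[where N = 0])
  have "summable (\<lambda>k. b k * (\<bar>B\<bar> + 1) ^ k)" using b by (simp add: entire_coeffs_def)
  then show "summable (\<lambda>k. norm (b k * B ^ k))" by (rule powser_insidea) simp
  show "norm (t k * b k) \<le> norm (b k * B ^ k)" for k
    using order_trans[OF t[of k] abs_ge_self]
    by (simp add: abs_mult mult.commute mult_left_mono del: power_abs)
qed

text \<open>Summation by parts: substitute \<open>a k = r k - x * r (Suc k)\<close> with
  \<open>r = resolvent x a\<close> and shift the index. The recurrence cancels the terms in
  \<open>x * t k\<close> and leaves the boundary term at 0. In the application \<open>t k\<close> is
  an entry of \<open>A ^\<^sub>m k\<close> and \<open>x\<close> a diagonal entry of
  \<open>A\<close>.\<close>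

lemma suminf_linear_recurrence:
  fixes t s :: "nat \<Rightarrow> real"
  assumes a: "entire_coeffs a" and t: "\<And>k. \<bar>t k\<bar> \<le> B ^ k"
    and rec: "\<And>k. t (Suc k) = x * t k + s k"
  shows "(\<lambda>k. s k * resolvent x a (Suc k)) sums ((\<Sum>k. t k * a k) - t 0 * resolvent x a 0)"
proof -
  let ?r = "resolvent x a"
  have r: "entire_coeffs ?r" by (rule entire_coeffs_resolvent[OF a])
  note sm = summable_mult_entire_coeffs[OF _ t]
  have "(\<lambda>k. t (Suc k) * ?r (Suc k)) sums ((\<Sum>k. t k * ?r k) - t 0 * ?r 0)"
    using summable_sums[OF sm[OF r]] by (subst sums_Suc_iff) simp
  moreover have "(\<lambda>k. x * (t k * ?r (Suc k))) sums (x * (\<Sum>k. t k * ?r (Suc k)))"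
    using sm[OF entire_coeffs_Suc[OF r]] by (intro sums_mult summable_sums)
  ultimately have "(\<lambda>k. t (Suc k) * ?r (Suc k) - x * (t k * ?r (Suc k))) sums
      ((\<Sum>k. t k * ?r k) - t 0 * ?r 0 - x * (\<Sum>k. t k * ?r (Suc k)))"
    by (rule sums_diff)
  then have 1: "(\<lambda>k. s k * ?r (Suc k)) sums
      ((\<Sum>k. t k * ?r k) - t 0 * ?r 0 - x * (\<Sum>k. t k * ?r (Suc k)))"
    by (simp add: rec distrib_right mult.assoc)
  have "t k * a k = t k * ?r k - x * (t k * ?r (Suc k))" for k
    using resolvent_rec[OF a, of x k] by (simp add: algebra_simps)
  then have "(\<Sum>k. t k * a k) = (\<Sum>k. t k * ?r k - x * (t k * ?r (Suc k)))"
    by simp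
  also have "\<dots> = (\<Sum>k. t k * ?r k) - x * (\<Sum>k. t k * ?r (Suc k))"
    using sm[OF r] sm[OF entire_coeffs_Suc[OF r]]
    using suminf_diff[OF sm[OF r] summable_mult[OF sm[OF entire_coeffs_Suc[OF r]], of x]]
      suminf_mult[OF sm[OF entire_coeffs_Suc[OF r]], of x] by simp
  finally have "(\<Sum>k. t k * a k) - t 0 * ?r 0
      = (\<Sum>k. t k * ?r k) - t 0 * ?r 0 - x * (\<Sum>k. t k * ?r (Suc k))"
    by simp
  with 1 show ?thesis by (simp only:)
qed


lemma pow_mat_Suc_entry:
  fixes A :: "'a :: semiring_1 mat"
  assumes "A \<in> carrier_mat n n" "i < n" "j < n"
  shows "(A ^\<^sub>m Suc k) $$ (i, j) = (\<Sum>l<n. (A ^\<^sub>m k) $$ (i, l) * A $$ (l, j))"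
  using assms by (auto simp: scalar_prod_def lessThan_atLeast0 intro!: sum.cong)

lemma upper_triangular_pow_mat_entry:
  fixes A :: "'a :: semiring_1 mat"
  assumes A: "A \<in> carrier_mat n n" "upper_triangular A" and "j < i" "i < n"
  shows "(A ^\<^sub>m k) $$ (i, j) = 0"
  using assms(3,4)
proof (induction k arbitrary: j)
  case 0
  then show ?case using A by simp
next
  case (Suc k)
  have "(A ^\<^sub>m k) $$ (i, l) * A $$ (l, j) = 0" if "l < n" for l
  proof (cases "l < i")
    case True
    then show ?thesis using Suc.IH[of l] Suc.prems by simp
  next
    case False
    then show ?thesis using A Suc.prems that by (auto simp: upper_triangular_def)
  qed
  then show ?case using Suc.prems pow_mat_Suc_entry[OF A(1), of i j k] by simp
qed

lemma of_real_pow_mat_entry: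
  fixes A :: "real mat"
  assumes A: "A \<in> carrier_mat n n" and "i < n" "j < n"
  shows "(map_mat complex_of_real A ^\<^sub>m k) $$ (i, j) = complex_of_real ((A ^\<^sub>m k) $$ (i, j))"
proof -
  have "map_mat complex_of_real A ^\<^sub>m k = map_mat complex_of_real (A ^\<^sub>m k)"
    by (rule of_real_hom.mat_hom_pow[OF A, symmetric])
  then show ?thesis using assms pow_carrier_mat[OF A, of k] by auto
qed

lemma pow_mat_entry_bound:
  fixes A :: "real mat"
  assumes A: "A \<in> carrier_mat n n"
  obtains B where "\<And>i j k. i < n \<Longrightarrow> j < n \<Longrightarrow> \<bar>(A ^\<^sub>m k) $$ (i, j)\<bar> \<le> B ^ k"
proof -
  define c where "c = Max ((\<lambda>(i, j). \<bar>A $$ (i, j)\<bar>) ` ({..<n} \<times> {..<n}))"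
  have c: "\<bar>A $$ (i, j)\<bar> \<le> c" if "i < n" "j < n" for i j
    unfolding c_def using that by (intro Max_ge) force+
  have "\<bar>(A ^\<^sub>m k) $$ (i, j)\<bar> \<le> (real n * c) ^ k" if "i < n" "j < n" for i j k
    using norm_pow_mat_entry_le[of "map_mat complex_of_real A" n c i j k] c A that
    by (simp add: of_real_pow_mat_entry[OF A that])
  then show ?thesis by (rule that)
qed

text \<open>Splitting off the diagonal entry of column \<open>j\<close> expresses the sum through
  columns \<open>l < j\<close> and the sequence of \<open>t \<mapsto> f[x, t]\<close>. Both the
  width \<open>Suc j - i\<close> and the order of nonnegative derivatives drop, so the induction
  runs over all sequences and columns at once.\<close>

lemma suminf_pow_mat_entry_nonneg:
  fixes A :: "real mat"
  assumes A: "A \<in> carrier_mat n n" "upper_triangular A" "\<forall>i<n. \<forall>j<n. 0 \<le> A $$ (i, j)"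
    and "entire_coeffs a" "nonneg_derivs m a" "i < n" "j < n" "Suc j - i \<le> m"
  shows "0 \<le> (\<Sum>k. (A ^\<^sub>m k) $$ (i, j) * a k)"
  using assms(4-)
proof (induction m arbitrary: a j)
  \<comment> \<open>Here truncated subtraction forces \<open>j < i\<close>: the entry lies below the
    diagonal, where all powers vanish.\<close>
  case 0
  then show ?case using upper_triangular_pow_mat_entry[OF A(1,2)] by simp
next
  case (Suc m)
  obtain B where B: "\<And>i j k. i < n \<Longrightarrow> j < n \<Longrightarrow> \<bar>(A ^\<^sub>m k) $$ (i, j)\<bar> \<le> B ^ k"
    using pow_mat_entry_bound[OF A(1)] by blast
  define x where "x = A $$ (j, j)"
  define b where "b k = resolvent x a (Suc k)" for k
  define s where "s k = (\<Sum>l<j. (A ^\<^sub>m k) $$ (i, l) * A $$ (l, j))" for k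
  have x: "x \<ge> 0" using A(3) Suc.prems by (simp add: x_def)
  have b: "entire_coeffs b" "nonneg_derivs m b"
    unfolding b_def using Suc.prems x
    by (auto intro: entire_coeffs_Suc entire_coeffs_resolvent nonneg_derivs_resolvent)
  have rec: "(A ^\<^sub>m Suc k) $$ (i, j) = x * (A ^\<^sub>m k) $$ (i, j) + s k" for k
  proof -
    have "(A ^\<^sub>m Suc k) $$ (i, j) = (\<Sum>l<n. (A ^\<^sub>m k) $$ (i, l) * A $$ (l, j))"
      by (rule pow_mat_Suc_entry[OF A(1) Suc.prems(3,4)])
    also have "\<dots> = (\<Sum>l<Suc j. (A ^\<^sub>m k) $$ (i, l) * A $$ (l, j))"
      using A(1,2) Suc.prems
      by (intro sum.mono_neutral_right) (auto simp: upper_triangular_def)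
    finally show ?thesis by (simp add: s_def x_def mult.commute)
  qed
  have "(\<lambda>k. s k * b k) sums
      ((\<Sum>k. (A ^\<^sub>m k) $$ (i, j) * a k) - (A ^\<^sub>m 0) $$ (i, j) * resolvent x a 0)"
    unfolding b_def
    by (rule suminf_linear_recurrence[OF Suc.prems(1) B[OF Suc.prems(3,4)] rec])
  moreover have "(\<lambda>k. s k * b k) sums (\<Sum>l<j. A $$ (l, j) * (\<Sum>k. (A ^\<^sub>m k) $$ (i, l) * b k))"
  proof -
    have "(\<lambda>k. \<Sum>l<j. A $$ (l, j) * ((A ^\<^sub>m k) $$ (i, l) * b k)) sums
        (\<Sum>l<j. A $$ (l, j) * (\<Sum>k. (A ^\<^sub>m k) $$ (i, l) * b k))"
      using Suc.prems
      by (intro sums_sum sums_mult summable_sums summable_mult_entire_coeffs[OF b(1) B]) auto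
    moreover have "s k * b k = (\<Sum>l<j. A $$ (l, j) * ((A ^\<^sub>m k) $$ (i, l) * b k))" for k
      unfolding s_def sum_distrib_right by (intro sum.cong) (simp_all add: mult_ac)
    ultimately show ?thesis by simp
  qed
  ultimately have "(\<Sum>k. (A ^\<^sub>m k) $$ (i, j) * a k) - (A ^\<^sub>m 0) $$ (i, j) * resolvent x a 0
      = (\<Sum>l<j. A $$ (l, j) * (\<Sum>k. (A ^\<^sub>m k) $$ (i, l) * b k))"
    by (rule sums_unique2)
  moreover have "0 \<le> (A ^\<^sub>m 0) $$ (i, j) * resolvent x a 0"
    using A(1) Suc.prems nonneg_derivs_eval[OF Suc.prems(2) x] by (intro mult_nonneg_nonneg) simp_all
  moreover have "0 \<le> (\<Sum>l<j. A $$ (l, j) * (\<Sum>k. (A ^\<^sub>m k) $$ (i, l) * b k))"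
    using A(3) Suc.prems b by (intro sum_nonneg mult_nonneg_nonneg Suc.IH) auto
  ultimately show ?case by linarith
qed

section \<open>Real sequences obtained from complex Taylor coefficients\<close>

definition taylor_coeff :: "(complex \<Rightarrow> complex) \<Rightarrow> nat \<Rightarrow> complex" where
  "taylor_coeff f k = (deriv ^^ k) f 0 / fact k"

text \<open>This is the Taylor series at 0 of the derivative of order \<open>m\<close>, whose
  coefficients are \<open>(k + m)! / k!\<close> times those of \<open>f\<close>.\<close>

lemma sums_higher_deriv:
  assumes f: "f holomorphic_on UNIV"
  shows "(\<lambda>k. of_nat ((k + m) choose m) * (taylor_coeff f (k + m) * z ^ k)) sums
           ((deriv ^^ m) f z / fact m)"
proof -
  have "(\<lambda>k. (deriv ^^ k) ((deriv ^^ m) f) 0 / fact k * (z - 0) ^ k) sums (deriv ^^ m) f z"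
    by (rule holomorphic_power_series[where r = "norm z + 1"])
       (auto intro!: holomorphic_higher_deriv holomorphic_on_subset[OF f])
  then have "(\<lambda>k. (deriv ^^ k) ((deriv ^^ m) f) 0 / fact k * (z - 0) ^ k / fact m) sums
      ((deriv ^^ m) f z / fact m)"
    by (rule sums_divide)
  then show ?thesis
    by (simp add: taylor_coeff_def funpow_add[symmetric, THEN fun_cong, simplified] binomial_fact mult_ac)
qed

lemma bounded_linear_mult_of_real:
  fixes \<phi> :: "complex \<Rightarrow> real"
  assumes "bounded_linear \<phi>"
  shows "\<phi> (of_real r * w) = r * \<phi> w"
  using linear_scale[OF bounded_linear.linear[OF assms], of r w]
  by (simp add: scaleR_conv_of_real)

lemma entire_coeffs_taylor:
  assumes f: "f holomorphic_on UNIV" and phi: "bounded_linear \<phi>"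
  shows "entire_coeffs (\<lambda>k. \<phi> (taylor_coeff f k))"
  unfolding entire_coeffs_def
proof
  fix x :: real
  have "summable (\<lambda>k. of_real (x ^ k) * taylor_coeff f k)"
    using sums_summable[OF sums_higher_deriv[OF f, of 0 "of_real x"]] by (simp add: mult.commute)
  from bounded_linear.summable[OF phi this] have "summable (\<lambda>k. x ^ k * \<phi> (taylor_coeff f k))"
    by (simp only: bounded_linear_mult_of_real[OF phi])
  then show "summable (\<lambda>k. \<phi> (taylor_coeff f k) * x ^ k)"
    by (simp only: mult.commute)
qed

lemma resolvent_power_taylor:
  assumes f: "f holomorphic_on UNIV" and phi: "bounded_linear \<phi>"
  shows "(resolvent x ^^ Suc m) (\<lambda>k. \<phi> (taylor_coeff f k)) m
           = \<phi> ((deriv ^^ m) f (of_real x) / fact m)"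
proof -
  have "(\<lambda>k. \<phi> (of_nat ((k + m) choose m) * (taylor_coeff f (k + m) * of_real x ^ k))) sums
      \<phi> ((deriv ^^ m) f (of_real x) / fact m)"
    by (rule bounded_linear.sums[OF phi sums_higher_deriv[OF f]])
  moreover have "\<phi> (of_nat ((k + m) choose m) * (taylor_coeff f (k + m) * of_real x ^ k))
      = real ((k + m) choose m) * (\<phi> (taylor_coeff f (k + m)) * x ^ k)" for k
  proof -
    have "of_nat ((k + m) choose m) * (taylor_coeff f (k + m) * of_real x ^ k)
        = of_real (real ((k + m) choose m) * x ^ k) * taylor_coeff f (k + m)"
      by (simp add: mult_ac)
    then have "\<phi> (of_nat ((k + m) choose m) * (taylor_coeff f (k + m) * of_real x ^ k))
        = real ((k + m) choose m) * x ^ k * \<phi> (taylor_coeff f (k + m))"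
      by (simp only: bounded_linear_mult_of_real[OF phi])
    then show ?thesis by (simp only: mult_ac)
  qed
  ultimately show ?thesis
    unfolding resolvent_power[OF entire_coeffs_taylor[OF f phi]] by (simp add: sums_iff)
qed

lemma nonneg_derivs_taylor:
  assumes f: "f holomorphic_on UNIV" and phi: "bounded_linear \<phi>"
  shows "nonneg_derivs n (\<lambda>k. \<phi> (taylor_coeff f k)) \<longleftrightarrow>
           (\<forall>j<n. \<forall>x\<ge>0. 0 \<le> \<phi> ((deriv ^^ j) f (of_real x)))"
proof -
  have "0 \<le> \<phi> (z / fact j) \<longleftrightarrow> 0 \<le> \<phi> z" for z j
    using bounded_linear_mult_of_real[OF phi, of "1 / fact j" z] by (simp add: pos_le_divide_eq)
  then show ?thesis
    unfolding nonneg_derivs_def resolvent_power_taylor[OF f phi] by simp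
qed

section \<open>Divided differences as iterated resolvents\<close>

lemma sorted_hd_eq_last:
  fixes xs :: "real list"
  assumes "sorted xs" "xs \<noteq> []" "hd xs = last xs"
  shows "xs = replicate (length xs) (hd xs)"
proof (rule replicate_eqI)
  fix y assume "y \<in> set xs"
  then obtain i where i: "i < length xs" "xs ! i = y" by (auto simp: in_set_conv_nth)
  then have "xs ! 0 \<le> y" "y \<le> xs ! (length xs - 1)"
    using sorted_nth_mono[OF assms(1)] by auto
  then show "y = hd xs" using assms by (simp add: hd_conv_nth last_conv_nth)
qed simp

lemma divided_difference_sorted_eq_last:
  assumes "xs \<noteq> []" "hd xs = last xs"
  shows "divided_difference_sorted f xs
    = (deriv ^^ (length xs - 1)) f (of_real (hd xs)) / fact (length xs - 1)"
  using assms by (cases "(f, xs)" rule: divided_difference_sorted.cases) (auto simp: Let_def)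

text \<open>Both branches of the recursion have a counterpart: coinciding points give a power of one
  resolvent, and distinct end points give \<open>fold_resolvent_ends\<close>. Sortedness ensures
  that equal end points mean a constant list.\<close>

lemma divided_difference_sorted_taylor:
  assumes f: "f holomorphic_on UNIV" and phi: "bounded_linear \<phi>"
    and "sorted xs" "xs \<noteq> []"
  shows "\<phi> (divided_difference_sorted f xs)
           = fold resolvent xs (\<lambda>k. \<phi> (taylor_coeff f k)) (length xs - 1)"
  using assms(3,4)
proof (induction xs rule: length_induct)
  case (1 xs)
  let ?c = "\<lambda>k. \<phi> (taylor_coeff f k)"
  show ?case
  proof (cases "hd xs = last xs")
    case True
    obtain m where m: "length xs = Suc m" using 1 by (cases xs) auto
    have "xs = replicate (Suc m) (hd xs)" using sorted_hd_eq_last[of xs] 1 True m by simp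
    then have "fold resolvent xs ?c m = (resolvent (hd xs) ^^ Suc m) ?c m"
      by (metis fold_replicate)
    then show ?thesis
      using 1 True m
      by (simp add: divided_difference_sorted_eq_last resolvent_power_taylor[OF f phi] del: funpow.simps)
  next
    case False
    obtain x ys where "xs = x # ys" using 1 by (cases xs) auto
    moreover then obtain ms y where "ys = ms @ [y]" using False by (cases ys rule: rev_cases) auto
    ultimately have xs: "xs = x # ms @ [y]" by simp
    have xy: "x \<noteq> y" using False by (simp add: xs)
    have rec: "divided_difference_sorted f xs =
        (divided_difference_sorted f (ms @ [y]) - divided_difference_sorted f (x # ms)) / of_real (y - x)"
      using xy by (cases ms) (simp_all add: xs)
    have "sorted (ms @ [y])" "sorted (x # ms)"
      using 1 by (auto simp: xs sorted_append)
    then have IH: "\<phi> (divided_difference_sorted f (ms @ [y])) = fold resolvent (ms @ [y]) ?c (length ms)"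
      "\<phi> (divided_difference_sorted f (x # ms)) = fold resolvent (x # ms) ?c (length ms)"
      using 1(1)[rule_format, of "ms @ [y]"] 1(1)[rule_format, of "x # ms"] by (auto simp: xs)
    have "\<phi> (divided_difference_sorted f xs) =
        (\<phi> (divided_difference_sorted f (ms @ [y])) - \<phi> (divided_difference_sorted f (x # ms))) / (y - x)"
      unfolding rec
      using bounded_linear_mult_of_real[OF phi, of "1 / (y - x)"]
        linear_diff[OF bounded_linear.linear[OF phi]] by simp
    also have "\<dots> = fold resolvent xs ?c (Suc (length ms))"
      unfolding IH using fold_resolvent_ends[OF entire_coeffs_taylor[OF f phi], of y x ms "length ms"] xy
      by (simp add: xs divide_simps mult.commute)
    finally show ?thesis by (simp add: xs)
  qed
qed

lemma divided_difference_replicate: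
  "divided_difference f (replicate (Suc j) x) = (deriv ^^ j) f (of_real x) / fact j"
proof -
  have "sort (replicate (Suc j) x) = replicate (Suc j) x"
    by (simp add: sorted_sort_id sorted_replicate del: replicate_Suc)
  then show ?thesis
    using divided_difference_sorted_eq_last[of "replicate (Suc j) x" f]
    by (simp add: divided_difference_def)
qed

section \<open>Matrix functions of real matrices and the equivalence of the conditions\<close>

lemma entire_mat_fun_jordan_block:
  assumes f: "f holomorphic_on UNIV" and j: "j < n"
  shows "entire_mat_fun f (map_mat complex_of_real (jordan_block n x)) $$ (0, j)
           = (deriv ^^ j) f (of_real x) / fact j"
proof -
  let ?g = "\<lambda>k. taylor_coeff f k * complex_of_real ((jordan_block n x ^\<^sub>m k) $$ (0, j))"
  have "entire_mat_fun f (map_mat complex_of_real (jordan_block n x)) $$ (0, j) = suminf ?g"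
    using j of_real_pow_mat_entry[of "jordan_block n x" n 0 j]
    by (simp add: entire_mat_fun_def taylor_coeff_def)
  \<comment> \<open>For \<open>k < j\<close> the exponent \<open>k - j\<close> is truncated to 0,
    but the binomial coefficient vanishes there. The series therefore starts at \<open>k = j\<close>
    and is that of the scaled derivative.\<close>
  moreover have g: "?g k = of_nat (k choose j) * (taylor_coeff f k * of_real x ^ (k - j))" for k
    using j by (simp add: jordan_block_pow)
  have "?g sums ((deriv ^^ j) f (of_real x) / fact j)"
  proof -
    have "(\<lambda>k. ?g (k + j)) sums ((deriv ^^ j) f (of_real x) / fact j)"
      unfolding g using sums_higher_deriv[OF f, of j "of_real x"] by simp
    moreover have "(\<Sum>k<j. ?g k) = 0" by (simp add: g binomial_eq_0)
    ultimately show ?thesis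
      by (subst sums_iff_shift'[of ?g j, symmetric]) (simp only: diff_0_right)
  qed
  ultimately show ?thesis by (simp add: sums_iff)
qed

lemma functional_entire_mat_fun:
  assumes f: "f holomorphic_on UNIV" and phi: "bounded_linear \<phi>"
    and A: "A \<in> carrier_mat n n" and "i < n" "j < n"
  shows "\<phi> (entire_mat_fun f (map_mat complex_of_real A) $$ (i, j))
           = (\<Sum>k. (A ^\<^sub>m k) $$ (i, j) * \<phi> (taylor_coeff f k))"
proof -
  let ?g = "\<lambda>k. of_real ((A ^\<^sub>m k) $$ (i, j)) * taylor_coeff f k"
  have "summable ?g"
    using summable_entire_mat_fun[OF f, of "map_mat complex_of_real A" n i j] assms(3-)
    by (simp add: of_real_pow_mat_entry taylor_coeff_def mult.commute)
  moreover have "entire_mat_fun f (map_mat complex_of_real A) $$ (i, j) = suminf ?g"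
    using assms(3-)
    by (simp add: entire_mat_fun_def of_real_pow_mat_entry taylor_coeff_def mult.commute)
  ultimately show ?thesis
    by (simp add: bounded_linear.suminf[OF phi] bounded_linear_mult_of_real[OF phi])
qed

text \<open>Vanishing of the imaginary part is written as two inequalities, so that the
  nonnegativity results for real sequences also yield realness.\<close>

lemma nonneg_Reals_iff_functionals:
  "z \<in> \<real>\<^sub>\<ge>\<^sub>0 \<longleftrightarrow> (\<forall>\<phi>\<in>{Re, Im, \<lambda>z. - Im z}. 0 \<le> \<phi> z)"
  by (auto simp: complex_nonneg_Reals_iff)

lemma bounded_linear_functionals:
  "\<phi> \<in> {Re, Im, \<lambda>z. - Im z} \<Longrightarrow> bounded_linear \<phi>"
  by (auto intro: bounded_linear_Re bounded_linear_Im bounded_linear_minus)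

lemma nonneg_Reals_divide_fact: "z / fact j \<in> \<real>\<^sub>\<ge>\<^sub>0 \<longleftrightarrow> z \<in> \<real>\<^sub>\<ge>\<^sub>0" for z :: complex
proof -
  have "complex_of_real r * z \<in> \<real>\<^sub>\<ge>\<^sub>0 \<longleftrightarrow> z \<in> \<real>\<^sub>\<ge>\<^sub>0" if "r > 0" for r
    using that by (auto simp: complex_nonneg_Reals_iff zero_le_mult_iff)
  from this[of "1 / fact j"] show ?thesis by simp
qed

theorem theorem6:
  fixes n :: nat and f :: "complex \<Rightarrow> complex"
  assumes "f holomorphic_on UNIV"
  shows "(preserves_nonneg_upper_triangular n f \<longleftrightarrow>
            (\<forall>k\<in>{1..n}. \<forall>xs :: real list. length xs = k \<and> (\<forall>x\<in>set xs. 0 \<le> x) \<longrightarrow>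
               divided_difference f xs \<in> \<real>\<^sub>\<ge>\<^sub>0))
       \<and> (preserves_nonneg_upper_triangular n f \<longleftrightarrow>
            (\<forall>j<n. \<forall>x::real. 0 \<le> x \<longrightarrow> (deriv ^^ j) f (complex_of_real x) \<in> \<real>\<^sub>\<ge>\<^sub>0))"
    (is "(?P \<longleftrightarrow> ?DD) \<and> (?P \<longleftrightarrow> ?D)")
proof -
  note f = assms
  \<comment> \<open>The derivative condition \<open>?D\<close> is the hub: \<open>?P\<close> and
    \<open>?DD\<close> are each shown equivalent to it, and both implications starting from
    \<open>?D\<close> use this form.\<close>
  have D: "nonneg_derivs n (\<lambda>k. \<phi> (taylor_coeff f k))"
    if ?D "\<phi> \<in> {Re, Im, \<lambda>z. - Im z}" for \<phi>
    unfolding nonneg_derivs_taylor[OF f bounded_linear_functionals[OF that(2)]]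
  proof (intro allI impI)
    fix j and x :: real
    assume "j < n" "0 \<le> x"
    with that(1) have "(deriv ^^ j) f (of_real x) \<in> \<real>\<^sub>\<ge>\<^sub>0" by blast
    then show "0 \<le> \<phi> ((deriv ^^ j) f (of_real x))"
      using that(2) by (rule nonneg_Reals_iff_functionals[THEN iffD1, THEN bspec])
  qed
  have "?D" if ?P
  proof (intro allI impI)
    fix j and x :: real
    assume j: "j < n" and x: "0 \<le> x"
    have "jordan_block n x \<in> carrier_mat n n \<and> upper_triangular (jordan_block n x) \<and>
        (\<forall>i<n. \<forall>j<n. 0 \<le> jordan_block n x $$ (i, j))"
      using x by (auto simp: jordan_block_def)
    then have "entire_mat_fun f (map_mat complex_of_real (jordan_block n x)) $$ (0, j) \<in> \<real>\<^sub>\<ge>\<^sub>0"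
      using that[unfolded preserves_nonneg_upper_triangular_def, rule_format] j by auto
    then show "(deriv ^^ j) f (of_real x) \<in> \<real>\<^sub>\<ge>\<^sub>0"
      by (simp add: entire_mat_fun_jordan_block[OF f j] nonneg_Reals_divide_fact)
  qed
  moreover have "?P" if ?D
    unfolding preserves_nonneg_upper_triangular_def nonneg_Reals_iff_functionals
  proof (intro allI impI ballI, elim conjE)
    fix A :: "real mat" and i j \<phi>
    assume A: "A \<in> carrier_mat n n" "upper_triangular A" "\<forall>i<n. \<forall>j<n. 0 \<le> A $$ (i, j)"
      and ij: "i < n" "j < n" and phi: "\<phi> \<in> {Re, Im, \<lambda>z. - Im z}"
    note lin = bounded_linear_functionals[OF phi]
    show "0 \<le> \<phi> (entire_mat_fun f (map_mat complex_of_real A) $$ (i, j))"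
      unfolding functional_entire_mat_fun[OF f lin A(1) ij]
      using ij by (intro suminf_pow_mat_entry_nonneg[OF A entire_coeffs_taylor[OF f lin] D[OF that phi]]) auto
  qed
  moreover have "?D" if ?DD
  proof (intro allI impI)
    fix j and x :: real
    assume "j < n" "0 \<le> x"
    \<comment> \<open>A constant list of \<open>j + 1\<close> points, admissible because
      \<open>j < n\<close>, recovers the derivative of order \<open>j\<close>.\<close>
    then have "divided_difference f (replicate (Suc j) x) \<in> \<real>\<^sub>\<ge>\<^sub>0"
      using that[rule_format, of "Suc j" "replicate (Suc j) x"] by auto
    then show "(deriv ^^ j) f (of_real x) \<in> \<real>\<^sub>\<ge>\<^sub>0"
      by (simp only: divided_difference_replicate nonneg_Reals_divide_fact)
  qed
  moreover have "?DD" if ?D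
    unfolding nonneg_Reals_iff_functionals
  proof (intro allI impI ballI, elim conjE)
    fix k \<phi> and xs :: "real list"
    assume k: "k \<in> {1..n}" "length xs = k" and nonneg: "\<forall>x\<in>set xs. 0 \<le> x"
      and phi: "\<phi> \<in> {Re, Im, \<lambda>z. - Im z}"
    note lin = bounded_linear_functionals[OF phi]
    have ne: "sort xs \<noteq> []" using k by (metis atLeastAtMost_iff length_sort list.size(3) not_one_le_zero)
    show "0 \<le> \<phi> (divided_difference f xs)"
      unfolding divided_difference_def divided_difference_sorted_taylor[OF f lin sorted_sort ne]
      using k nonneg ne
      by (intro fold_resolvent_nonneg[OF entire_coeffs_taylor[OF f lin] D[OF that phi]]) auto
  qed
  ultimately show ?thesis by blast
qed

end
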